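(* Let $\widetilde W$ be an irreducible affine Weyl group with positive root system $\widetilde\Phi^+$. For any $x\in\widetilde W$, any $n\in\mathbb N$ and any biclosed set $B$ in $\widetilde\Phi^+$, the set $$\{y\in\widetilde W \mid y\le_B x,\ l_B(x)-l_B(y)=n\}$$ is finite, where $\le_B$ is the (left) $B$-twisted strong Bruhat order and $l_B$ is the (left) $B$-twisted length.
   Context: Affine root system: $\Phi$ is a finite irreducible crystallographic root system in a Euclidean space $V$, with Weyl group $W$, standard positive system $\Phi^+$, $\Phi^-=-\Phi^+$, simple system $\Delta$ and highest root $\rho$. Put $V'=V\oplus\mathbb R\delta$ and extend the inner product by $(\delta,v)=0$ for all $v\in V'$. For $\alpha\in\Phi^+$ let $\{\alpha\}^\wedge=\{\alpha+n\delta\mid n\in\mathbb Z_{\ge0}\}$; for $\alpha\in\Phi^-$ let $\{\alpha\}^\wedge=\{\alpha+(n+1)\delta\mid n\in\mathbb Z_{\ge0}\}$; for $\Lambda\subset\Phi$ let $\Lambda^\wedge=\bigcup_{\alpha\in\Lambda}\{\alpha\}^\wedge$. Positive roots: $\widetilde\Phi^+=\Phi^\wedge$; all roots: $\widetilde\Phi=\Phi^\wedge\uplus-\Phi^\wedge$. $\widetilde W$ is the group generated by the reflections $s_\gamma(v)=v-2\frac{(v,\gamma)}{(\gamma,\gamma)}\gamma$, $\gamma\in\widetilde\Phi$; it is a Coxeter group with simple reflections those in the simple roots $\Delta\cup\{\delta-\rho\}$ and length function $l$. Inversion set: $N(w)=\{\gamma\in\widetilde\Phi^+\mid w^{-1}(\gamma)\in-\widetilde\Phi^+\}$.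 Biclosed: $\Gamma\subset\widetilde\Phi$ is closed if $\alpha,\beta\in\Gamma$, $k_1,k_2\in\mathbb R_{\ge0}$, $k_1\alpha+k_2\beta\in\widetilde\Phi$ imply $k_1\alpha+k_2\beta\in\Gamma$; $B\subset\widetilde\Phi^+$ is biclosed if $B$ and $\widetilde\Phi^+\setminus B$ are both closed. Twisted length: $l_B(w)=l(w)-2|N(w^{-1})\cap B|$. Twisted strong Bruhat order: $x\le_B y$ iff $y=t_kt_{k-1}\cdots t_1x$ for some $k\ge0$ and reflections $t_i$ of $\widetilde W$ with $l_B(t_i\cdots t_1x)=l_B(t_{i-1}\cdots t_1x)+1$ for $1\le i\le k$. *)

theory Defs
  imports "HOL-Analysis.Analysis"
begin

section \<open>Finite root systems\<close>

definition reflect :: "'a::euclidean_space \<Rightarrow> 'a \<Rightarrow> 'a" where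
  "reflect \<alpha> v = v - (2 * (v \<bullet> \<alpha>) / (\<alpha> \<bullet> \<alpha>)) *\<^sub>R \<alpha>"

definition root_system :: "'a::euclidean_space set \<Rightarrow> bool" where
  "root_system \<Phi> \<longleftrightarrow>
     finite \<Phi> \<and> 0 \<notin> \<Phi> \<and> span \<Phi> = UNIV \<and>
     (\<forall>\<alpha>\<in>\<Phi>. \<forall>c::real. c *\<^sub>R \<alpha> \<in> \<Phi> \<longleftrightarrow> c = 1 \<or> c = -1) \<and>
     (\<forall>\<alpha>\<in>\<Phi>. reflect \<alpha> ` \<Phi> = \<Phi>)"

definition crystallographic :: "'a::euclidean_space set \<Rightarrow> bool" where
  "crystallographic \<Phi> \<longleftrightarrow> (\<forall>\<alpha>\<in>\<Phi>. \<forall>\<beta>\<in>\<Phi>. 2 * (\<beta> \<bullet> \<alpha>) / (\<alpha> \<bullet> \<alpha>) \<in> \<int>)"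

definition irreducible_roots :: "'a::euclidean_space set \<Rightarrow> bool" where
  "irreducible_roots \<Phi> \<longleftrightarrow>
     \<Phi> \<noteq> {} \<and>
     \<not> (\<exists>\<Phi>1 \<Phi>2. \<Phi>1 \<noteq> {} \<and> \<Phi>2 \<noteq> {} \<and> \<Phi>1 \<union> \<Phi>2 = \<Phi> \<and> \<Phi>1 \<inter> \<Phi>2 = {} \<and>
                (\<forall>\<alpha>\<in>\<Phi>1. \<forall>\<beta>\<in>\<Phi>2. \<alpha> \<bullet> \<beta> = 0))"

definition nonneg_combs :: "'a::euclidean_space set \<Rightarrow> 'a set" where
  "nonneg_combs \<Delta> = {\<Sum>\<alpha>\<in>\<Delta>. real (c \<alpha>) *\<^sub>R \<alpha> | c :: 'a \<Rightarrow> nat. True}"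

definition simple_system :: "'a::euclidean_space set \<Rightarrow> 'a set \<Rightarrow> bool" where
  "simple_system \<Phi> \<Delta> \<longleftrightarrow>
     \<Delta> \<subseteq> \<Phi> \<and> independent \<Delta> \<and> span \<Delta> = UNIV \<and>
     (\<forall>\<beta>\<in>\<Phi>. \<beta> \<in> nonneg_combs \<Delta> \<or> - \<beta> \<in> nonneg_combs \<Delta>)"

definition pos_roots :: "'a::euclidean_space set \<Rightarrow> 'a set \<Rightarrow> 'a set" where
  "pos_roots \<Phi> \<Delta> = \<Phi> \<inter> nonneg_combs \<Delta>"

text \<open>The maximum of \<open>\<Phi>\<close> for the root order, in which \<open>\<alpha>\<close> is below \<open>\<beta>\<close> when
  \<open>\<beta> - \<alpha>\<close> is a sum of simple roots.\<close>

definition highest_root :: "'a::euclidean_space set \<Rightarrow> 'a set \<Rightarrow> 'a \<Rightarrow> bool" where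
  "highest_root \<Phi> \<Delta> \<rho> \<longleftrightarrow> \<rho> \<in> \<Phi> \<and> (\<forall>\<alpha>\<in>\<Phi>. \<rho> - \<alpha> \<in> nonneg_combs \<Delta>)"

section \<open>Affine root systems\<close>

text \<open>The space \<open>V \<oplus> \<real>\<delta>\<close> is the type \<open>'a \<times> real\<close>: the pair \<open>(v, c)\<close> stands for \<open>v + c\<delta>\<close>.
  The extended form is degenerate, with \<open>\<delta>\<close> in its radical; it is not the inner product
  that the library puts on the product type.\<close>

definition aform :: "'a::euclidean_space \<times> real \<Rightarrow> 'a \<times> real \<Rightarrow> real" where
  "aform u v = fst u \<bullet> fst v"

definition areflect :: "'a::euclidean_space \<times> real \<Rightarrow> 'a \<times> real \<Rightarrow> 'a \<times> real" where
  "areflect \<gamma> v = v - (2 * aform v \<gamma> / aform \<gamma> \<gamma>) *\<^sub>R \<gamma>"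

text \<open>Only used for \<open>\<Lambda> \<subseteq> \<Phi>\<close>, where the roots outside \<open>pos_roots \<Phi> \<Delta>\<close> are the negative roots.\<close>

definition hat :: "'a::euclidean_space set \<Rightarrow> 'a set \<Rightarrow> 'a set \<Rightarrow> ('a \<times> real) set" where
  "hat \<Phi> \<Delta> \<Lambda> =
     (\<Union>\<alpha>\<in>\<Lambda>. if \<alpha> \<in> pos_roots \<Phi> \<Delta> then {(\<alpha>, real n) | n. True}
            else {(\<alpha>, real (n + 1)) | n. True})"

definition aff_pos_roots :: "'a::euclidean_space set \<Rightarrow> 'a set \<Rightarrow> ('a \<times> real) set" where
  "aff_pos_roots \<Phi> \<Delta> = hat \<Phi> \<Delta> \<Phi>"

definition aff_roots :: "'a::euclidean_space set \<Rightarrow> 'a set \<Rightarrow> ('a \<times> real) set" where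
  "aff_roots \<Phi> \<Delta> = aff_pos_roots \<Phi> \<Delta> \<union> uminus ` aff_pos_roots \<Phi> \<Delta>"

definition aff_simple_roots :: "'a::euclidean_space set \<Rightarrow> 'a \<Rightarrow> ('a \<times> real) set" where
  "aff_simple_roots \<Delta> \<rho> = (\<lambda>\<alpha>. (\<alpha>, 0)) ` \<Delta> \<union> {(- \<rho>, 1)}"

section \<open>The affine Weyl group\<close>

text \<open>The generators are involutions, so closing under composition already gives a group.\<close>

inductive_set aff_weyl ::
    "'a::euclidean_space set \<Rightarrow> 'a set \<Rightarrow> ('a \<times> real \<Rightarrow> 'a \<times> real) set"
  for \<Phi> \<Delta> where
  one: "id \<in> aff_weyl \<Phi> \<Delta>"
| mult: "\<gamma> \<in> aff_roots \<Phi> \<Delta> \<Longrightarrow> w \<in> aff_weyl \<Phi> \<Delta> \<Longrightarrow> areflect \<gamma> \<circ> w \<in> aff_weyl \<Phi> \<Delta>"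

text \<open>Coxeter length: the least length of a word in the simple reflections.\<close>

definition aff_length ::
    "'a::euclidean_space set \<Rightarrow> 'a \<Rightarrow> ('a \<times> real \<Rightarrow> 'a \<times> real) \<Rightarrow> nat" where
  "aff_length \<Delta> \<rho> w =
     (LEAST k. \<exists>\<gamma>s. length \<gamma>s = k \<and> set \<gamma>s \<subseteq> aff_simple_roots \<Delta> \<rho> \<and>
                    w = foldr (\<circ>) (map areflect \<gamma>s) id)"

definition inversions ::
    "'a::euclidean_space set \<Rightarrow> 'a set \<Rightarrow> ('a \<times> real \<Rightarrow> 'a \<times> real) \<Rightarrow> ('a \<times> real) set" where
  "inversions \<Phi> \<Delta> w =
     {\<gamma> \<in> aff_pos_roots \<Phi> \<Delta>. inv w \<gamma> \<in> uminus ` aff_pos_roots \<Phi> \<Delta>}"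

section \<open>Biclosed sets and the twisted Bruhat order\<close>

definition closed_roots ::
    "'a::euclidean_space set \<Rightarrow> 'a set \<Rightarrow> ('a \<times> real) set \<Rightarrow> bool" where
  "closed_roots \<Phi> \<Delta> \<Gamma> \<longleftrightarrow>
     \<Gamma> \<subseteq> aff_roots \<Phi> \<Delta> \<and>
     (\<forall>\<alpha>\<in>\<Gamma>. \<forall>\<beta>\<in>\<Gamma>. \<forall>k1 k2 :: real. k1 \<ge> 0 \<longrightarrow> k2 \<ge> 0 \<longrightarrow>
        k1 *\<^sub>R \<alpha> + k2 *\<^sub>R \<beta> \<in> aff_roots \<Phi> \<Delta> \<longrightarrow> k1 *\<^sub>R \<alpha> + k2 *\<^sub>R \<beta> \<in> \<Gamma>)"

definition biclosed ::
    "'a::euclidean_space set \<Rightarrow> 'a set \<Rightarrow> ('a \<times> real) set \<Rightarrow> bool" where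
  "biclosed \<Phi> \<Delta> B \<longleftrightarrow>
     B \<subseteq> aff_pos_roots \<Phi> \<Delta> \<and> closed_roots \<Phi> \<Delta> B \<and>
     closed_roots \<Phi> \<Delta> (aff_pos_roots \<Phi> \<Delta> - B)"

definition twisted_length ::
    "'a::euclidean_space set \<Rightarrow> 'a set \<Rightarrow> 'a \<Rightarrow> ('a \<times> real) set \<Rightarrow>
     ('a \<times> real \<Rightarrow> 'a \<times> real) \<Rightarrow> int" where
  "twisted_length \<Phi> \<Delta> \<rho> B w =
     int (aff_length \<Delta> \<rho> w) - 2 * int (card (inversions \<Phi> \<Delta> (inv w) \<inter> B))"

definition twisted_step ::
    "'a::euclidean_space set \<Rightarrow> 'a set \<Rightarrow> 'a \<Rightarrow> ('a \<times> real) set \<Rightarrow>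
     ('a \<times> real \<Rightarrow> 'a \<times> real) \<Rightarrow> ('a \<times> real \<Rightarrow> 'a \<times> real) \<Rightarrow> bool" where
  "twisted_step \<Phi> \<Delta> \<rho> B u v \<longleftrightarrow>
     (\<exists>\<gamma>\<in>aff_roots \<Phi> \<Delta>. v = areflect \<gamma> \<circ> u) \<and>
     twisted_length \<Phi> \<Delta> \<rho> B v = twisted_length \<Phi> \<Delta> \<rho> B u + 1"

definition twisted_le ::
    "'a::euclidean_space set \<Rightarrow> 'a set \<Rightarrow> 'a \<Rightarrow> ('a \<times> real) set \<Rightarrow>
     ('a \<times> real \<Rightarrow> 'a \<times> real) \<Rightarrow> ('a \<times> real \<Rightarrow> 'a \<times> real) \<Rightarrow> bool" where
  "twisted_le \<Phi> \<Delta> \<rho> B = (twisted_step \<Phi> \<Delta> \<rho> B)\<^sup>*\<^sup>*"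

end

theory Submission
  imports Defs
begin

text \<open>
  It suffices that only finitely many \<open>y = x s\<^sub>\<beta>\<close> with \<open>\<beta>\<close> a positive root have
  \<open>l\<^sub>B(y) = l\<^sub>B(x) - 1\<close>; then one inducts on \<open>n\<close>. Let \<open>N(w)\<close> here be the set of positive roots made
  negative by \<open>w\<close>. Since \<open>l(w) = |N(w)|\<close>, the twisted length \<open>l\<^sub>B(w)\<close> is the sum over \<open>N(w)\<close> of the
  weight that is \<open>-1\<close> on \<open>B\<close> and \<open>1\<close> off \<open>B\<close>. The sets \<open>N(x s\<^sub>\<beta>)\<close> and \<open>N(s\<^sub>\<beta>)\<close> differ in at most
  \<open>2 l(x)\<close> elements, so it is enough that \<open>|l\<^sub>B(s\<^sub>\<beta>)|\<close> tends to infinity along each of the finitely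
  many strings \<open>\<beta> = \<alpha> + k\<delta>\<close>. By convexity such a string lies eventually inside \<open>B\<close> or eventually
  outside. On \<open>N(s\<^sub>\<beta>)\<close> the involution \<open>\<gamma> \<mapsto> - s\<^sub>\<beta> \<gamma>\<close> pairs roots whose sum is a positive
  multiple of \<open>\<beta>\<close>, so biclosedness forces every pair sum of weights to have the sign of the weight of
  \<open>\<beta>\<close> or to vanish, while the pairs \<open>\<alpha> + m\<delta>, \<alpha> + (2k - m)\<delta>\<close> contribute an amount growing
  linearly in \<open>k\<close>.
\<close>

section \<open>Affine reflections and the degenerate form\<close>

lemma areflect_add: "areflect g (u + v) = areflect g u + areflect g v"
  by (simp add: areflect_def aform_def inner_add_left add_divide_distrib algebra_simps)

lemma areflect_scaleR: "areflect g (c *\<^sub>R v) = c *\<^sub>R areflect g v"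
  by (simp add: areflect_def aform_def algebra_simps)

lemma linear_areflect: "linear (areflect g)"
  by (rule linearI) (simp_all add: areflect_add areflect_scaleR)

lemma areflect_minus [simp]: "areflect g (- v) = - areflect g v"
  using areflect_scaleR[of g "-1" v] by simp

lemma areflect_uminus_root: "areflect (- g) = areflect g"
  by (simp add: areflect_def aform_def fun_eq_iff)

lemma areflect_self: "fst g \<noteq> 0 \<Longrightarrow> areflect g g = - g"
  by (simp add: areflect_def aform_def algebra_simps scaleR_2)

lemma aform_areflect: "aform (areflect g u) (areflect g v) = aform u v"
proof (cases "fst g = 0")
  case False
  then show ?thesis
    by (simp add: areflect_def aform_def inner_diff_left inner_diff_right inner_commute field_simps)
next
  \<comment> \<open>With \<open>fst g = 0\<close> the form vanishes against \<open>g\<close>, so the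
    coefficient is \<open>0 / 0 = 0\<close> and the reflection is the identity.\<close>
  case True
  then show ?thesis by (simp add: areflect_def aform_def)
qed

lemma areflect_areflect [simp]: "areflect g (areflect g v) = v"
proof (cases "fst g = 0")
  case False
  then have "areflect g (areflect g v)
    = areflect g v - (2 * aform v g / aform g g) *\<^sub>R areflect g g"
    by (metis areflect_def linear_areflect linear_diff linear_scale)
  also have "\<dots> = v"
    by (simp add: areflect_self[OF False]) (simp add: areflect_def)
  finally show ?thesis .
next
  case True
  then show ?thesis by (simp add: areflect_def aform_def)
qed

lemma areflect_comp_self: "areflect g \<circ> areflect g = id"
  by (simp add: fun_eq_iff)

lemma bij_areflect: "bij (areflect g)"
  by (rule o_bij[OF areflect_comp_self areflect_comp_self])

text \<open>A reflection is built from the form and the linear structure alone, so a linear isometry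
  carries it along. This form avoids an inverse of \<open>u\<close>.\<close>

lemma areflect_conjugate:
  assumes "linear u" "\<And>v w. aform (u v) (u w) = aform v w"
  shows "areflect (u g) \<circ> u = u \<circ> areflect g"
  using assms(2) by (simp add: fun_eq_iff areflect_def linear_diff[OF assms(1)] linear_scale[OF assms(1)])

text \<open>The common terms cancel. With \<open>f\<close> a weight, nearby inversion sets thus give
  nearby twisted lengths.\<close>

lemma abs_sum_symmetric_difference_le:
  fixes f :: "'b \<Rightarrow> int"
  assumes "finite A" "finite C" "\<And>x. \<bar>f x\<bar> \<le> 1"
  shows "\<bar>sum f A - sum f C\<bar> \<le> int (card (A - C)) + int (card (C - A))"
proof -
  have "sum f A = sum f (A - C) + sum f (A \<inter> C)" "sum f C = sum f (C - A) + sum f (A \<inter> C)"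
    using assms sum.Int_Diff[of A f C] sum.Int_Diff[of C f A] by (simp_all add: Int_commute)
  moreover have "\<bar>sum f D\<bar> \<le> int (card D)" for D
    using order_trans[OF sum_abs sum_bounded_above[of D "\<lambda>x. \<bar>f x\<bar>" 1]] assms by auto
  from this[of "A - C"] this[of "C - A"]
  have "\<bar>sum f (A - C)\<bar> \<le> int (card (A - C))" "\<bar>sum f (C - A)\<bar> \<le> int (card (C - A))" .
  ultimately show ?thesis by linarith
qed

section \<open>Finite roots and affine roots\<close>

locale affine_root_data =
  fixes \<Phi> \<Delta> :: "'a::euclidean_space set" and \<rho> :: 'a
  assumes root_system: "root_system \<Phi>" and crystallographic: "crystallographic \<Phi>"
    and simple_system: "simple_system \<Phi> \<Delta>" and highest_root: "highest_root \<Phi> \<Delta> \<rho>"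
begin

abbreviation "P \<equiv> aff_pos_roots \<Phi> \<Delta>"
abbreviation "R \<equiv> aff_roots \<Phi> \<Delta>"
abbreviation "S \<equiv> aff_simple_roots \<Delta> \<rho>"
abbreviation "W \<equiv> aff_weyl \<Phi> \<Delta>"

lemma finite_roots: "finite \<Phi>"
  and root_nonzero: "\<alpha> \<in> \<Phi> \<Longrightarrow> \<alpha> \<noteq> 0"
  and root_multiple: "\<alpha> \<in> \<Phi> \<Longrightarrow> c *\<^sub>R \<alpha> \<in> \<Phi> \<Longrightarrow> c = 1 \<or> c = -1"
  using root_system by (auto simp: root_system_def)

lemma root_reflect: "\<alpha> \<in> \<Phi> \<Longrightarrow> \<beta> \<in> \<Phi> \<Longrightarrow> reflect \<alpha> \<beta> \<in> \<Phi>"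
  using root_system unfolding root_system_def by blast

lemma root_uminus: "\<alpha> \<in> \<Phi> \<Longrightarrow> - \<alpha> \<in> \<Phi>"
  using root_system unfolding root_system_def
  by (metis scaleR_minus1_left)

lemma cartan_integer: "\<alpha> \<in> \<Phi> \<Longrightarrow> \<beta> \<in> \<Phi> \<Longrightarrow> 2 * (\<beta> \<bullet> \<alpha>) / (\<alpha> \<bullet> \<alpha>) \<in> \<int>"
  using crystallographic by (auto simp: crystallographic_def)

lemma simple_subset: "\<Delta> \<subseteq> \<Phi>"
  and independent_simple: "independent \<Delta>"
  and span_simple: "span \<Delta> = UNIV"
  and root_cases: "\<alpha> \<in> \<Phi> \<Longrightarrow> \<alpha> \<in> nonneg_combs \<Delta> \<or> - \<alpha> \<in> nonneg_combs \<Delta>"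
  using simple_system by (auto simp: simple_system_def)

lemma finite_simple: "finite \<Delta>"
  using simple_subset finite_roots finite_subset by blast

lemma highest: "\<rho> \<in> \<Phi>" "\<alpha> \<in> \<Phi> \<Longrightarrow> \<rho> - \<alpha> \<in> nonneg_combs \<Delta>"
  using highest_root by (auto simp: highest_root_def)

text \<open>Adding the two combinations gives a vanishing combination of independent vectors with
  nonnegative coefficients. Hence no root is both positive and negative.\<close>

lemma nonneg_combs_pointed:
  assumes "v \<in> nonneg_combs \<Delta>" "- v \<in> nonneg_combs \<Delta>" shows "v = 0"
proof -
  obtain c d where c: "v = (\<Sum>\<alpha>\<in>\<Delta>. real (c \<alpha>) *\<^sub>R \<alpha>)"
    and d: "- v = (\<Sum>\<alpha>\<in>\<Delta>. real (d \<alpha>) *\<^sub>R \<alpha>)"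
    using assms by (auto simp: nonneg_combs_def)
  have "(\<Sum>\<alpha>\<in>\<Delta>. (real (c \<alpha>) + real (d \<alpha>)) *\<^sub>R \<alpha>) = v + - v"
    unfolding d by (simp add: c scaleR_add_left sum.distrib)
  then have "\<forall>\<alpha>\<in>\<Delta>. real (c \<alpha>) + real (d \<alpha>) = 0"
    using independentD[OF independent_simple finite_simple order_refl,
        of "\<lambda>\<alpha>. real (c \<alpha>) + real (d \<alpha>)"] by simp
  then have "\<forall>\<alpha>\<in>\<Delta>. c \<alpha> = 0" by auto
  then show ?thesis using c by simp
qed

text \<open>Replaces the case split of \<open>hat\<close> by a condition on the level
  \<open>r\<close>: all of \<open>\<Phi>\<close> occurs at each positive integer level, only the
  positive roots at level 0.\<close>

lemma mem_P_iff:
  "(v, r) \<in> P \<longleftrightarrow> v \<in> \<Phi> \<and> r \<in> \<int> \<and> r \<ge> 0 \<and> (r = 0 \<longrightarrow> v \<in> pos_roots \<Phi> \<Delta>)"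
proof
  assume "(v, r) \<in> P"
  then show "v \<in> \<Phi> \<and> r \<in> \<int> \<and> r \<ge> 0 \<and> (r = 0 \<longrightarrow> v \<in> pos_roots \<Phi> \<Delta>)"
    by (auto simp: aff_pos_roots_def hat_def split: if_splits)
next
  assume a: "v \<in> \<Phi> \<and> r \<in> \<int> \<and> r \<ge> 0 \<and> (r = 0 \<longrightarrow> v \<in> pos_roots \<Phi> \<Delta>)"
  then obtain n where n: "r = real n"
    by (metis Ints_cases nonneg_int_cases of_int_0_le_iff of_int_of_nat_eq)
  show "(v, r) \<in> P"
  proof (cases "v \<in> pos_roots \<Phi> \<Delta>")
    case True
    then show ?thesis using a n by (auto simp: aff_pos_roots_def hat_def)
  next
    case False
    then obtain m where "n = m + 1" using a n by (cases n) auto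
    then show ?thesis using False a n
      by (auto simp: aff_pos_roots_def hat_def intro!: bexI[of _ v])
  qed
qed

lemma mem_R_iff: "(v, r) \<in> R \<longleftrightarrow> v \<in> \<Phi> \<and> r \<in> \<int>"
proof -
  have "(v, r) \<in> R \<longleftrightarrow> (v, r) \<in> P \<or> (- v, - r) \<in> P"
    unfolding aff_roots_def
    by (metis (no_types, lifting) Un_iff add.inverse_inverse image_iff uminus_Pair)
  then show ?thesis
    using root_uminus[of v] root_uminus[of "- v"] root_cases[of v]
    by (cases r "0::real" rule: linorder_cases) (auto simp: mem_P_iff pos_roots_def)
qed

lemma P_subset_R: "P \<subseteq> R"
  by (auto simp: aff_roots_def)

lemma R_cases: "g \<in> R \<Longrightarrow> g \<in> P \<or> - g \<in> P"
  by (auto simp: aff_roots_def)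

lemma mem_uminus_P: "g \<in> uminus ` P \<longleftrightarrow> - g \<in> P"
  by (metis (no_types, lifting) add.inverse_inverse image_iff)

lemma P_asym: "g \<in> P \<Longrightarrow> - g \<notin> P"
  using nonneg_combs_pointed[of "fst g"] root_nonzero[of "fst g"]
  by (cases g) (auto simp: mem_P_iff pos_roots_def)

lemma R_fst_nonzero: "g \<in> R \<Longrightarrow> fst g \<noteq> 0"
  using root_nonzero by (cases g) (auto simp: mem_R_iff)

lemma aform_pos: "g \<in> R \<Longrightarrow> aform g g > 0"
  using R_fst_nonzero by (simp add: aform_def)

lemma aff_cartan_integer: "g \<in> R \<Longrightarrow> h \<in> R \<Longrightarrow> 2 * aform h g / aform g g \<in> \<int>"
  using cartan_integer by (cases g; cases h) (auto simp: mem_R_iff aform_def)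

lemma areflect_R:
  assumes "g \<in> R" "h \<in> R" shows "areflect g h \<in> R"
proof (cases g; cases h)
  fix a k b m assume "g = (a, k)" "h = (b, m)"
  then show ?thesis
    using assms root_reflect[of a b] cartan_integer[of a b] Ints_mult[of "2 * (b \<bullet> a) / (a \<bullet> a)" k]
    by (auto simp: mem_R_iff areflect_def reflect_def aform_def)
qed

lemma simple_subset_P: "S \<subseteq> P"
proof -
  have "a \<in> pos_roots \<Phi> \<Delta>" if "a \<in> \<Delta>" for a
  proof -
    have "a = (\<Sum>b\<in>\<Delta>. real (if b = a then 1 else 0) *\<^sub>R b)"
      using that finite_simple by (simp add: if_distrib[of real] if_distrib[of "\<lambda>c. c *\<^sub>R _"] sum.delta cong: if_cong)
    then show ?thesis using that simple_subset
      by (auto simp: pos_roots_def nonneg_combs_def intro!: exI[of _ "\<lambda>b. if b = a then 1 else 0"])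
  qed
  then show ?thesis
    using highest(1) root_uminus simple_subset by (auto simp: aff_simple_roots_def mem_P_iff)
qed

lemma finite_aff_simple: "finite S"
  by (simp add: aff_simple_roots_def finite_simple)

section \<open>Coordinates in the affine simple roots\<close>

lemma span_aff_simple: "span S = UNIV"
proof -
  have *: "(v, 0) \<in> span S" for v
  proof -
    have "(\<lambda>a. (a, 0::real)) ` span \<Delta> \<subseteq> span ((\<lambda>a. (a, 0)) ` \<Delta>)"
      by (subst linear_span_image[symmetric]) (auto intro!: linearI)
    then show ?thesis
      using span_simple span_mono[of "(\<lambda>a. (a, 0)) ` \<Delta>" S] by (auto simp: aff_simple_roots_def)
  qed
  have "(v, r) \<in> span S" for v r
  proof -
    have "(v, r) = (v + r *\<^sub>R \<rho>, 0) + r *\<^sub>R (- \<rho>, 1)" by simp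
    also have "\<dots> \<in> span S"
      by (intro span_add * span_scale span_base) (simp add: aff_simple_roots_def)
    finally show ?thesis .
  qed
  then show ?thesis by auto
qed

lemma independent_aff_simple: "independent S"
proof -
  have "independent ((\<lambda>a. (a, 0::real)) ` \<Delta>)"
    by (intro linear_independent_injective_image independent_simple)
       (auto intro!: linearI simp: inj_on_def)
  moreover have "(- \<rho>, 1) \<notin> span ((\<lambda>a. (a, 0::real)) ` \<Delta>)"
  proof -
    have "span ((\<lambda>a. (a, 0::real)) ` \<Delta>) = (\<lambda>a. (a, 0::real)) ` span \<Delta>"
      by (rule linear_span_image) (auto intro!: linearI)
    then show ?thesis by auto
  qed
  ultimately show ?thesis
    by (simp add: aff_simple_roots_def independent_insertI)
qed

text \<open>\<open>S\<close> is a basis of the whole space and \<open>representation\<close> is 0 at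
  indices outside the basis, so the rules of linearity hold without side conditions.\<close>

abbreviation "coord \<equiv> representation S"

lemma coord_add: "coord (u + v) a = coord u a + coord v a"
  using representation_add[OF independent_aff_simple] span_aff_simple by auto

lemma coord_scale: "coord (c *\<^sub>R v) a = c * coord v a"
  using representation_scale[OF independent_aff_simple] span_aff_simple by auto

lemma coord_uminus: "coord (- v) a = - coord v a"
  using coord_scale[of "-1" v a] by simp

lemma coord_diff: "coord (u - v) a = coord u a - coord v a"
  using coord_add[of u "- v" a] by (simp add: coord_uminus)

lemma coord_sum: "coord (\<Sum>i\<in>I. f i) a = (\<Sum>i\<in>I. coord (f i) a)"
  using representation_sum[OF independent_aff_simple, of I f] span_aff_simple by simp

lemma coord_simple: "b \<in> S \<Longrightarrow> coord b a = (if a = b then 1 else 0)"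
  using representation_basis[OF independent_aff_simple] by auto

lemma coord_expand: "(\<Sum>a\<in>S. coord v a *\<^sub>R a) = v"
  using sum_representation_eq[OF independent_aff_simple, of v S] span_aff_simple finite_aff_simple
  by auto

lemma coord_nonneg_combs:
  assumes "v \<in> nonneg_combs \<Delta>" shows "coord (v, 0) a \<ge> 0"
proof -
  obtain c where c: "v = (\<Sum>\<alpha>\<in>\<Delta>. real (c \<alpha>) *\<^sub>R \<alpha>)"
    using assms by (auto simp: nonneg_combs_def)
  have "(v, 0) = (\<Sum>\<alpha>\<in>\<Delta>. real (c \<alpha>) *\<^sub>R (\<alpha>, 0::real))"
    by (simp add: c prod_eq_iff fst_sum snd_sum)
  moreover have "coord (\<alpha>, 0) a \<ge> 0" if "\<alpha> \<in> \<Delta>" for \<alpha>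
    using that by (subst coord_simple) (auto simp: aff_simple_roots_def)
  ultimately show ?thesis by (simp add: coord_sum coord_scale sum_nonneg del: scaleR_Pair)
qed

text \<open>This is where \<open>\<rho>\<close> being the highest root enters: at level
  \<open>r \<ge> 1\<close>, splitting off \<open>r\<close> copies of \<open>(- \<rho>, 1)\<close>
  leaves \<open>v + r *\<^sub>R \<rho>\<close> at level 0.\<close>

lemma coord_nonneg:
  assumes "g \<in> P" shows "coord g a \<ge> 0"
proof (cases g)
  case (Pair v r)
  show ?thesis
  proof (cases "r = 0")
    case True
    then show ?thesis
      using assms Pair coord_nonneg_combs[of v a] by (auto simp: mem_P_iff pos_roots_def)
  next
    case False
    then have r: "r \<ge> 1" "v \<in> \<Phi>"
      using assms Pair by (auto simp: mem_P_iff elim!: Ints_cases)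
    \<comment> \<open>\<open>\<rho>\<close> dominates the roots \<open>- v\<close> and \<open>- \<rho>\<close>, so \<open>\<rho> + v\<close> and \<open>2\<rho>\<close> are nonnegative combinations.\<close>
    have 1: "coord (\<rho> + v, 0) a \<ge> 0"
      using highest(2)[OF root_uminus[OF r(2)]] coord_nonneg_combs by simp
    have "coord (2 *\<^sub>R (\<rho>, 0)) a \<ge> 0"
      using highest(2)[OF root_uminus[OF highest(1)]] coord_nonneg_combs by (simp add: scaleR_2)
    then have 2: "coord (\<rho>, 0) a \<ge> 0" by (simp only: coord_scale)
    have 3: "coord (- \<rho>, 1) a \<ge> 0" by (subst coord_simple) (auto simp: aff_simple_roots_def)
    have "g = (\<rho> + v, 0) + (r - 1) *\<^sub>R (\<rho>, 0) + r *\<^sub>R (- \<rho>, 1)"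
      using Pair by (simp add: algebra_simps)
    then have "coord g a = coord (\<rho> + v, 0) a + (r - 1) * coord (\<rho>, 0) a + r * coord (- \<rho>, 1) a"
      by (simp only: coord_add coord_scale)
    then show ?thesis using 1 2 3 r by simp
  qed
qed

text \<open>Reflecting in \<open>a\<close> changes only the coordinate at \<open>a\<close>. If the
  image were negative, all other coordinates of \<open>g\<close> would be both nonnegative and
  nonpositive, so \<open>g\<close> would be a multiple of \<open>a\<close>, hence \<open>a\<close>
  itself.\<close>

lemma areflect_simple_P:
  assumes "a \<in> S" "g \<in> P" "g \<noteq> a" shows "areflect a g \<in> P"
proof (rule ccontr)
  assume n: "areflect a g \<notin> P"
  have R: "a \<in> R" "g \<in> R" using assms simple_subset_P P_subset_R by auto
  have neg: "- areflect a g \<in> P" using R areflect_R R_cases n by blast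
  define c where "c = 2 * aform g a / aform a a"
  have e: "areflect a g = g - c *\<^sub>R a" by (simp add: areflect_def c_def)
  have "coord g b = 0" if "b \<noteq> a" for b
    using coord_nonneg[OF neg, of b] coord_nonneg[OF assms(2), of b] that
    by (simp add: e coord_uminus coord_diff coord_scale coord_simple[OF assms(1)])
  then have "(\<Sum>b\<in>S. coord g b *\<^sub>R b) = (\<Sum>b\<in>S. if b = a then coord g a *\<^sub>R a else 0)"
    by (intro sum.cong) auto
  then have g: "g = coord g a *\<^sub>R a" using assms(1) finite_aff_simple by (simp add: coord_expand)
  then have "coord g a = 1 \<or> coord g a = -1"
    using R root_multiple[of "fst a" "coord g a"] by (cases a; cases g) (auto simp: mem_R_iff)
  then show False using g assms(3) coord_nonneg[OF assms(2), of a] by auto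
qed

section \<open>Words in the simple reflections and the exchange property\<close>

definition wd :: "('a \<times> real) list \<Rightarrow> 'a \<times> real \<Rightarrow> 'a \<times> real" where
  "wd gs = foldr (\<circ>) (map areflect gs) id"

lemma wd_Nil [simp]: "wd [] = id"
  and wd_Cons [simp]: "wd (g # gs) = areflect g \<circ> wd gs"
  by (simp_all add: wd_def)

lemma wd_append: "wd (gs @ hs) = wd gs \<circ> wd hs"
  by (induction gs) (simp_all add: comp_assoc)

text \<open>As \<open>aform g g > 0\<close>, some simple \<open>a\<close> has positive form with
  \<open>g\<close>. If \<open>g\<close> is not simple, \<open>areflect a g\<close> is a lower
  positive root, and conjugating its reflection by \<open>areflect a\<close> gives back that of
  \<open>g\<close>.\<close>

lemma word_of_reflection:
  "g \<in> P \<Longrightarrow> \<exists>gs. set gs \<subseteq> S \<and> areflect g = wd gs"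
\<comment> \<open>The height is rounded down because the coordinates are only known to be real; it
  still decreases, since each reflection lowers the height by an integer
  \<open>c \<ge> 1\<close>.\<close>
proof (induction "nat \<lfloor>\<Sum>a\<in>S. coord g a\<rfloor>" arbitrary: g rule: less_induct)
  case less
  show ?case
  proof (cases "g \<in> S")
    case True
    then show ?thesis by (intro exI[of _ "[g]"]) auto
  next
    case False
    have gR: "g \<in> R" using less.prems P_subset_R by auto
    have "aform g g = (\<Sum>a\<in>S. coord g a * aform g a)"
      by (subst (2) coord_expand[symmetric])
         (simp add: aform_def fst_sum inner_sum_right)
    then have "(\<Sum>a\<in>S. coord g a * aform g a) > 0" using aform_pos[OF gR] by simp
    then obtain a where a: "a \<in> S" "coord g a * aform g a > 0"
      using sum_nonpos[of S "\<lambda>a. coord g a * aform g a"] by (meson linorder_not_less)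
    then have "aform g a > 0" using coord_nonneg[OF less.prems, of a] by (simp add: zero_less_mult_iff)
    have aR: "a \<in> R" using a simple_subset_P P_subset_R by auto
    define c where "c = 2 * aform g a / aform a a"
    have "c > 0" using \<open>aform g a > 0\<close> aform_pos[OF aR] by (simp add: c_def)
    moreover have "c \<in> \<int>" unfolding c_def using aff_cartan_integer aR gR by blast
    ultimately have c1: "c \<ge> 1" by (auto elim!: Ints_cases)
    have h: "areflect a g \<in> P" using areflect_simple_P a False less.prems by metis
    have "(\<Sum>b\<in>S. coord (areflect a g) b) = (\<Sum>b\<in>S. coord g b) - c"
      using a(1) finite_aff_simple
      by (simp add: areflect_def c_def[symmetric] coord_diff coord_scale coord_simple[OF a(1)]
           sum_subtractf if_distrib[of "(*) c"] cong: if_cong)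
    moreover have "(\<Sum>b\<in>S. coord (areflect a g) b) \<ge> 0" using coord_nonneg[OF h] by (simp add: sum_nonneg)
    ultimately have "nat \<lfloor>\<Sum>b\<in>S. coord (areflect a g) b\<rfloor> < nat \<lfloor>\<Sum>b\<in>S. coord g b\<rfloor>"
      using c1 by linarith
    then obtain gs where gs: "set gs \<subseteq> S" "areflect (areflect a g) = wd gs"
      using less.hyps h by blast
    have "areflect (areflect a g) \<circ> areflect a = areflect a \<circ> areflect g"
      by (rule areflect_conjugate[OF linear_areflect aform_areflect])
    then have "areflect g = areflect a \<circ> (wd gs \<circ> areflect a)"
      by (metis areflect_comp_self comp_assoc id_comp gs(2))
    then have "areflect g = wd (a # gs @ [a])" by (simp add: wd_append)
    then show ?thesis using a(1) gs(1) by (intro exI[of _ "a # gs @ [a]"]) auto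
  qed
qed

lemma word_of_weyl: "w \<in> W \<Longrightarrow> \<exists>gs. set gs \<subseteq> S \<and> w = wd gs"
proof (induction rule: aff_weyl.induct)
  case one
  show ?case by (intro exI[of _ "[]"]) auto
next
  case (mult g w)
  obtain hs where hs: "set hs \<subseteq> S" "areflect g = wd hs"
    using R_cases[OF mult(1)] word_of_reflection[of g] word_of_reflection[of "- g"]
    unfolding areflect_uminus_root by blast
  obtain gs where "set gs \<subseteq> S" "w = wd gs" using mult by blast
  then show ?case using hs by (intro exI[of _ "hs @ gs"]) (auto simp: wd_append)
qed

lemma weyl_linear: "w \<in> W \<Longrightarrow> linear w"
  and weyl_bij: "w \<in> W \<Longrightarrow> bij w"
  and weyl_aform: "w \<in> W \<Longrightarrow> aform (w u) (w v) = aform u v"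
  and weyl_R: "w \<in> W \<Longrightarrow> g \<in> R \<Longrightarrow> w g \<in> R"
proof (induction rule: aff_weyl.induct)
  case one
  { case 1 show ?case by (rule linearI) simp_all }
  { case 2 show ?case by (rule bij_id) }
  { case 3 show ?case by simp }
  { case 4 then show ?case by simp }
next
  case (mult g w)
  { case 1 show ?case using mult linear_compose linear_areflect by blast }
  { case 2 show ?case using mult bij_comp bij_areflect by blast }
  { case 3 show ?case using mult by (simp add: aform_areflect) }
  { case 4 then show ?case using mult areflect_R by simp }
qed

lemma weyl_uminus: "w \<in> W \<Longrightarrow> w (- v) = - w v"
  using weyl_linear linear_neg by blast

lemma weyl_inv_R:
  assumes "w \<in> W" "g \<in> R" shows "inv w g \<in> R"
  using assms
proof (induction arbitrary: g rule: aff_weyl.induct)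
  case (mult h w)
  have "inv (areflect h \<circ> w) = inv w \<circ> inv (areflect h)"
    by (rule o_inv_distrib[OF bij_areflect weyl_bij[OF mult(2)]])
  also have "inv (areflect h) = areflect h"
    by (rule inv_unique_comp[OF areflect_comp_self areflect_comp_self])
  finally have "inv (areflect h \<circ> w) = inv w \<circ> areflect h" .
  then show ?case using mult areflect_R by (metis comp_apply)
qed simp

lemma word_weyl: "set gs \<subseteq> S \<Longrightarrow> wd gs \<in> W"
  using simple_subset_P P_subset_R
  by (induction gs) (auto intro!: aff_weyl.intros)

lemma reflection_weyl: "g \<in> R \<Longrightarrow> areflect g \<in> W"
  using aff_weyl.mult[OF _ aff_weyl.one] by simp

text \<open>Reading the word from the right, the image of the positive root \<open>a\<close> first
  turns negative at some letter \<open>b\<close>. There the image equals \<open>b\<close>, so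
  \<open>b\<close> can be moved to the right end as a second \<open>a\<close>, and the two
  cancel.\<close>

lemma deletion:
  assumes "set gs \<subseteq> S" "a \<in> S" "- wd gs a \<in> P"
  shows "\<exists>hs. set hs \<subseteq> S \<and> wd hs = wd (gs @ [a]) \<and> length hs < length gs"
  using assms
proof (induction gs)
  case Nil
  then show ?case using P_asym[of a] simple_subset_P by auto
next
  case (Cons b gs)
  show ?case
  proof (cases "- wd gs a \<in> P")
    case True
    then obtain hs where "set hs \<subseteq> S" "wd hs = wd (gs @ [a])" "length hs < length gs"
      using Cons by auto
    then show ?thesis using Cons.prems by (intro exI[of _ "b # hs"]) auto
  next
    case False
    let ?u = "wd gs"
    have u: "?u \<in> W" using Cons.prems word_weyl by auto
    have "a \<in> R" using Cons.prems simple_subset_P P_subset_R by auto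
    then have "?u a \<in> P" using False R_cases weyl_R[OF u] by blast
    then have "?u a = b"
      using Cons.prems areflect_simple_P[of b "?u a"] P_asym[of "areflect b (?u a)"] by auto
    then have "areflect b \<circ> ?u = ?u \<circ> areflect a"
      using areflect_conjugate[OF weyl_linear[OF u] weyl_aform[OF u]] by metis
    then have "wd ((b # gs) @ [a]) = ?u \<circ> (areflect a \<circ> areflect a)"
      by (simp add: wd_append o_assoc)
    then show ?thesis using Cons.prems by (intro exI[of _ gs]) (auto simp: areflect_comp_self)
  qed
qed

section \<open>Length and inversion sets\<close>

abbreviation "len \<equiv> aff_length \<Delta> \<rho>"

text \<open>The inversion set of the inverse of \<open>w\<close>, which is the one in the twisted
  length of \<open>w\<close>, written without \<open>inv\<close>.\<close>

definition N where "N w = {g \<in> P. - w g \<in> P}"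

lemma inversions_inv: "w \<in> W \<Longrightarrow> inversions \<Phi> \<Delta> (inv w) = N w"
  by (simp add: inversions_def N_def mem_uminus_P inv_inv_eq weyl_bij)

lemma length_word_le: "set gs \<subseteq> S \<Longrightarrow> len (wd gs) \<le> length gs"
  unfolding aff_length_def wd_def by (intro Least_le) auto

lemma reduced_word:
  assumes "w \<in> W" shows "\<exists>gs. length gs = len w \<and> set gs \<subseteq> S \<and> w = wd gs"
proof -
  have "\<exists>k gs. length gs = k \<and> set gs \<subseteq> S \<and> w = wd gs"
    using word_of_weyl[OF assms] by blast
  from LeastI_ex[OF this] show ?thesis unfolding aff_length_def wd_def .
qed

text \<open>Appending a letter \<open>a\<close> to a word for \<open>u\<close> with
  \<open>u a\<close> positive adds exactly one inversion. In a reduced word \<open>u a\<close>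
  cannot be negative, as \<open>deletion\<close> would shorten the word.\<close>

lemma card_N_reduced_word:
  "set gs \<subseteq> S \<Longrightarrow> len (wd gs) = length gs \<Longrightarrow> finite (N (wd gs)) \<and> card (N (wd gs)) = length gs"
proof (induction gs rule: rev_induct)
  case Nil
  have "N (wd []) = {}" using P_asym by (auto simp: N_def)
  then show ?case by (simp only: finite.emptyI card.empty list.size)
next
  case (snoc a gs)
  let ?u = "wd gs" and ?s = "areflect a"
  have a: "a \<in> S" "a \<in> P" "a \<in> R" and gs: "set gs \<subseteq> S"
    using snoc.prems simple_subset_P P_subset_R by auto
  have u: "?u \<in> W" using word_weyl gs by blast
  have min: "length hs \<ge> length (gs @ [a])" if "set hs \<subseteq> S" "wd hs = wd (gs @ [a])" for hs
    using length_word_le[of hs] that snoc.prems by metis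
  \<comment> \<open>A prefix of a reduced word is reduced: a shorter word for \<open>?u\<close>,
    followed by \<open>a\<close>, would be too short for the whole product.\<close>
  obtain hs where hs: "length hs = len ?u" "set hs \<subseteq> S" "?u = wd hs" using reduced_word[OF u] by auto
  have "wd (hs @ [a]) = wd (gs @ [a])" by (simp add: wd_append hs(3)[symmetric])
  then have "length hs \<ge> length gs" using min[of "hs @ [a]"] hs a by auto
  then have "len ?u = length gs" using hs length_word_le[OF gs] by auto
  then have IH: "finite (N ?u)" "card (N ?u) = length gs" using snoc.IH gs by auto
  have "- ?u a \<notin> P"
  proof
    assume "- ?u a \<in> P"
    then obtain hs where "set hs \<subseteq> S" "wd hs = wd (gs @ [a])" "length hs < length gs"
      using deletion[OF gs a(1)] by blast
    then show False using min[of hs] by simp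
  qed
  then have ua: "?u a \<in> P" using R_cases weyl_R[OF u a(3)] by blast
  have sa: "?s a = - a" using areflect_self R_fst_nonzero a by blast
  have w: "wd (gs @ [a]) = ?u \<circ> ?s" by (simp add: wd_append)
  \<comment> \<open>\<open>?s\<close> permutes the positive roots other than \<open>a\<close>; the
    root \<open>a\<close> is inverted because \<open>?s a = - a\<close> and \<open>?u a\<close> is
    positive.\<close>
  have N: "N (?u \<circ> ?s) = insert a (?s ` N ?u)"
  proof (intro set_eqI iffI)
    fix g assume g: "g \<in> N (?u \<circ> ?s)"
    show "g \<in> insert a (?s ` N ?u)"
    proof (cases "g = a")
      case False
      then have "?s g \<in> N ?u" using g areflect_simple_P[OF a(1)] by (auto simp: N_def)
      then have "?s (?s g) \<in> ?s ` N ?u" by (rule imageI)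
      then show ?thesis by simp
    qed simp
  next
    fix g assume "g \<in> insert a (?s ` N ?u)"
    then consider "g = a" | h where "g = ?s h" "h \<in> N ?u" by auto
    then show "g \<in> N (?u \<circ> ?s)"
    proof cases
      case 1
      then show ?thesis using a ua sa by (simp add: N_def weyl_uminus[OF u])
    next
      case 2
      then have "h \<noteq> a" using ua P_asym[OF ua] by (auto simp: N_def)
      then show ?thesis using 2 areflect_simple_P[OF a(1), of h] by (simp add: N_def)
    qed
  qed
  have "a \<notin> ?s ` N ?u"
  proof
    assume "a \<in> ?s ` N ?u"
    then obtain h where "h \<in> P" "a = ?s h" by (auto simp: N_def)
    then have "- a = h" using sa areflect_areflect by metis
    then show False using P_asym[OF a(2)] \<open>h \<in> P\<close> by simp
  qed
  moreover have "card (?s ` N ?u) = card (N ?u)"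
    by (intro card_image inj_on_subset[OF bij_is_inj[OF bij_areflect]]) simp
  ultimately show ?case unfolding w N using IH by simp
qed

lemma finite_N: "w \<in> W \<Longrightarrow> finite (N w)"
  and length_eq_card_N: "w \<in> W \<Longrightarrow> len w = card (N w)"
  using reduced_word[of w] card_N_reduced_word by metis+

section \<open>Twisted lengths of reflections\<close>

lemma twisted_length_eq_sum:
  assumes "w \<in> W"
  shows "twisted_length \<Phi> \<Delta> \<rho> B w = (\<Sum>g\<in>N w. if g \<in> B then - 1 else 1)"
proof -
  have "(\<Sum>g\<in>N w. if g \<in> B then - 1 else 1 :: int) = (\<Sum>g\<in>N w. 1 - 2 * (if g \<in> B then 1 else 0))"
    by (intro sum.cong) auto
  also have "\<dots> = int (card (N w)) - 2 * int (card (N w \<inter> B))"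
    using finite_N[OF assms]
    by (simp add: sum_subtractf sum_distrib_left[symmetric] sum.inter_restrict[symmetric])
  finally show ?thesis
    by (simp add: twisted_length_def inversions_inv assms length_eq_card_N)
qed

lemma weyl_comp: "u \<in> W \<Longrightarrow> w \<in> W \<Longrightarrow> u \<circ> w \<in> W"
  by (induction rule: aff_weyl.induct) (auto simp: comp_assoc intro: aff_weyl.mult)

text \<open>If exactly one of the two inversion sets contains \<open>g\<close>, then
  \<open>areflect b g\<close> or its negative is inverted by \<open>x\<close>. So each of the two
  set differences has at most \<open>card (N x)\<close> elements, whatever \<open>b\<close>
  is.\<close>

lemma twisted_length_right_reflection:
  assumes x: "x \<in> W" and b: "b \<in> R"
  shows "\<bar>twisted_length \<Phi> \<Delta> \<rho> B (x \<circ> areflect b) - twisted_length \<Phi> \<Delta> \<rho> B (areflect b)\<bar>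
    \<le> 2 * int (card (N x))"
proof -
  let ?s = "areflect b"
  have W: "?s \<in> W" "x \<circ> ?s \<in> W" using reflection_weyl weyl_comp x b by auto
  have "N (x \<circ> ?s) - N ?s \<subseteq> ?s ` N x"
  proof
    fix g assume g: "g \<in> N (x \<circ> ?s) - N ?s"
    then have "?s g \<in> R" using areflect_R[OF b, of g] P_subset_R by (auto simp: N_def)
    then have "?s g \<in> N x" using g R_cases[of "?s g"] by (auto simp: N_def)
    then have "?s (?s g) \<in> ?s ` N x" by (rule imageI)
    then show "g \<in> ?s ` N x" by simp
  qed
  then have 1: "card (N (x \<circ> ?s) - N ?s) \<le> card (N x)"
    using finite_N[OF x] by (meson card_image_le card_mono finite_imageI le_trans)
  have "N ?s - N (x \<circ> ?s) \<subseteq> (\<lambda>g. ?s (- g)) ` N x"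
  proof
    fix g assume g: "g \<in> N ?s - N (x \<circ> ?s)"
    then have "?s g \<in> R" using areflect_R[OF b, of g] P_subset_R by (auto simp: N_def)
    then have "x (?s g) \<in> R" using weyl_R x by blast
    then have "- ?s g \<in> N x" using g R_cases[of "x (?s g)"] by (auto simp: N_def weyl_uminus[OF x])
    then have "?s (- (- ?s g)) \<in> (\<lambda>g. ?s (- g)) ` N x" by (rule imageI)
    then show "g \<in> (\<lambda>g. ?s (- g)) ` N x" by simp
  qed
  then have 2: "card (N ?s - N (x \<circ> ?s)) \<le> card (N x)"
    using finite_N[OF x] by (meson card_image_le card_mono finite_imageI le_trans)
  have "\<bar>twisted_length \<Phi> \<Delta> \<rho> B (x \<circ> ?s) - twisted_length \<Phi> \<Delta> \<rho> B ?s\<bar>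
    \<le> int (card (N (x \<circ> ?s) - N ?s)) + int (card (N ?s - N (x \<circ> ?s)))"
    unfolding twisted_length_eq_sum[OF W(1)] twisted_length_eq_sum[OF W(2)]
    by (rule abs_sum_symmetric_difference_le[OF finite_N[OF W(2)] finite_N[OF W(1)]]) simp
  then show ?thesis using 1 2 by linarith
qed

text \<open>The involution \<open>g \<mapsto> - s\<^sub>b g\<close> of \<open>N s\<^sub>b\<close> satisfies \<open>g - s\<^sub>b g = c b\<close> with \<open>c > 0\<close>. Hence if \<open>b \<in> C\<close>
  and the complement of \<open>C\<close> is closed, then every orbit meets \<open>C\<close>; the orbits in the
  \<open>\<delta>\<close>-string through \<open>b\<close> lie inside \<open>C\<close> up to boundedly many.\<close>

lemma reflection_sum_lower_bound:
  assumes C: "closed_roots \<Phi> \<Delta> (P - C)" and \<alpha>: "\<alpha> \<in> \<Phi>"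
    and M: "M \<ge> 1" "\<And>m. m \<ge> M \<Longrightarrow> (\<alpha>, real m) \<in> C" and k: "k \<ge> M"
  shows "(\<Sum>g\<in>N (areflect (\<alpha>, real k)). if g \<in> C then 1 else - 1) \<ge> int k - int M"
proof -
  define b where "b = (\<alpha>, real k)"
  define f :: "'a \<times> real \<Rightarrow> int" where "f g = (if g \<in> C then 1 else - 1)" for g
  let ?s = "areflect b" and ?\<sigma> = "\<lambda>g. - areflect b g"
  have bR: "b \<in> R" using \<alpha> by (simp add: b_def mem_R_iff)
  have bP: "b \<in> P" using \<alpha> M(1) k by (simp add: b_def mem_P_iff)
  have bC: "b \<in> C" using M k by (simp add: b_def)
  have fin: "finite (N ?s)" using finite_N reflection_weyl bR by blast
  have "bij_betw ?\<sigma> (N ?s) (N ?s)"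
    by (rule bij_betw_byWitness[where f' = ?\<sigma>]) (auto simp: N_def)
  then have "sum f (N ?s) = (\<Sum>g\<in>N ?s. f (?\<sigma> g))"
    by (rule sum.reindex_bij_betw[symmetric])
  \<comment> \<open>Doubling sums over the orbits without choosing representatives or treating fixed
    points apart.\<close>
  then have eq: "2 * sum f (N ?s) = (\<Sum>g\<in>N ?s. f g + f (?\<sigma> g))" by (simp add: sum.distrib)
  have pair: "g \<in> C \<or> ?\<sigma> g \<in> C" if g: "g \<in> N ?s" for g
  proof (rule ccontr)
    assume n: "\<not> (g \<in> C \<or> ?\<sigma> g \<in> C)"
    define c where "c = 2 * aform g b / aform b b"
    have s: "?s g = g - c *\<^sub>R b" by (simp add: areflect_def c_def)
    have P: "g \<in> P" "?\<sigma> g \<in> P" using g by (auto simp: N_def)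
    \<comment> \<open>The levels of \<open>g\<close> and \<open>?\<sigma> g\<close> are nonnegative
      and add up to \<open>c * real k\<close>, which excludes \<open>c < 0\<close>; for
      \<open>c = 0\<close> the two roots would be opposite.\<close>
    have "c > 0"
    proof (rule ccontr)
      assume "\<not> c > 0"
      then consider "c = 0" | "c < 0" by linarith
      then show False
      proof cases
        case 1 then show ?thesis using P P_asym s by auto
      next
        case 2
        then have "c * real k < 0" using M(1) k by (simp add: mult_neg_pos)
        then show ?thesis using P s
          by (cases g; cases "?\<sigma> g") (auto simp: mem_P_iff b_def)
      qed
    qed
    then have "b = (1 / c) *\<^sub>R g + (1 / c) *\<^sub>R ?\<sigma> g"
      by (simp add: s algebra_simps)
    moreover have "(1 / c) *\<^sub>R g + (1 / c) *\<^sub>R ?\<sigma> g \<in> R \<Longrightarrow> (1 / c) *\<^sub>R g + (1 / c) *\<^sub>R ?\<sigma> g \<in> P - C"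
      using C P n \<open>c > 0\<close> unfolding closed_roots_def by (meson DiffI divide_nonneg_pos zero_le_one)
    ultimately have "b \<in> P - C" using bR by auto
    then show False using bC by simp
  qed
  \<comment> \<open>The window is symmetric about \<open>k\<close>, because \<open>?\<sigma>\<close>
    sends level \<open>m\<close> to \<open>2 * k - m\<close>; so both members of each pair have
    level at least \<open>M\<close>.\<close>
  define T where "T = (\<lambda>m. (\<alpha>, real m)) ` {M..2 * k - M}"
  have s: "?\<sigma> (\<alpha>, real m) = (\<alpha>, real (2 * k - m))" if "m \<le> 2 * k - M" for m
    using root_nonzero[OF \<alpha>] that by (simp add: b_def areflect_def aform_def scaleR_2 of_nat_diff)
  have "T \<subseteq> N ?s"
  proof
    fix g assume "g \<in> T"
    then obtain m where m: "M \<le> m" "m \<le> 2 * k - M" and g: "g = (\<alpha>, real m)" by (auto simp: T_def)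
    then have "m \<ge> 1" "2 * k - m \<ge> 1" using M k by auto
    then have "(\<alpha>, real m) \<in> P" "(\<alpha>, real (2 * k - m)) \<in> P" 
      using \<alpha> by (auto simp: mem_P_iff simp del: of_nat_diff of_nat_diff_if)
    then show "g \<in> N ?s" using s[OF m(2)] g by (simp add: N_def)
  qed
  have "(\<Sum>g\<in>T. 2) \<le> (\<Sum>g\<in>T. f g + f (?\<sigma> g))"
  proof (rule sum_mono)
    fix g assume "g \<in> T"
    then obtain m where m: "M \<le> m" "m \<le> 2 * k - M" and g: "g = (\<alpha>, real m)" by (auto simp: T_def)
    have "g \<in> C" using M(2) m g by simp
    moreover have "?\<sigma> g \<in> C" using M(2)[of "2 * k - m"] s m g k by simp
    ultimately show "2 \<le> f g + f (?\<sigma> g)" by (simp add: f_def)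
  qed
  also have "\<dots> \<le> (\<Sum>g\<in>N ?s. f g + f (?\<sigma> g))"
    using pair by (intro sum_mono2 fin \<open>T \<subseteq> N ?s\<close>) (auto simp: f_def)
  finally have "2 * int (card T) \<le> 2 * sum f (N ?s)" by (simp add: eq)
  moreover have "card T = 2 * k - M + 1 - M"
    unfolding T_def by (subst card_image) (auto simp: inj_on_def)
  \<comment> \<open>The window has \<open>2 * (k - M) + 1\<close> elements, which is more than the
    bound asks for.\<close>
  ultimately show ?thesis using k by (simp add: b_def f_def of_nat_diff)
qed

text \<open>If \<open>B\<close> meets the string at arbitrarily high levels, every level beyond the
  first one found lies between two levels in \<open>B\<close> and is a convex combination of
  them.\<close>

lemma eventually_mem_or_not_mem:
  assumes B: "closed_roots \<Phi> \<Delta> B" and \<alpha>: "\<alpha> \<in> \<Phi>"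
  obtains M where "M \<ge> 1" "(\<forall>m\<ge>M. (\<alpha>, real m) \<in> B) \<or> (\<forall>m\<ge>M. (\<alpha>, real m) \<notin> B)"
proof (cases "\<exists>M\<ge>1. \<forall>m\<ge>M. (\<alpha>, real m) \<notin> B")
  case True
  then show ?thesis using that by blast
next
  case False
  then obtain p where p: "p \<ge> 1" "(\<alpha>, real p) \<in> B" by blast
  have "(\<alpha>, real m) \<in> B" if m: "m \<ge> p" for m
  proof -
    obtain q where q: "q \<ge> m + 1" "(\<alpha>, real q) \<in> B" using False p by force
    define t where "t = (real m - real p) / (real q - real p)"
    have t: "0 \<le> t" "t \<le> 1" using m q by (auto simp: t_def)
    have "t * (real q - real p) = real m - real p" using m q by (simp add: t_def)
    then have e: "(1 - t) *\<^sub>R (\<alpha>, real p) + t *\<^sub>R (\<alpha>, real q) = (\<alpha>, real m)"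
      by (simp add: algebra_simps)
    moreover have "(\<alpha>, real m) \<in> R" using \<alpha> by (simp add: mem_R_iff)
    ultimately show ?thesis using B p q t unfolding closed_roots_def
      by (metis diff_ge_0_iff_ge)
  qed
  then show ?thesis using that p by blast
qed

text \<open>The lower bound is applied to whichever of \<open>B\<close> and \<open>P - B\<close>
  contains a tail of the string; the twisted length tends to minus or plus infinity accordingly,
  hence the absolute value.\<close>

lemma reflection_twisted_length_unbounded:
  assumes B: "biclosed \<Phi> \<Delta> B" and \<alpha>: "\<alpha> \<in> \<Phi>"
  obtains K where "\<And>k. k \<ge> K \<Longrightarrow> \<bar>twisted_length \<Phi> \<Delta> \<rho> B (areflect (\<alpha>, real k))\<bar> > L"
proof -
  have sub: "B \<subseteq> P" and cl: "closed_roots \<Phi> \<Delta> B" "closed_roots \<Phi> \<Delta> (P - B)"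
    using B by (auto simp: biclosed_def)
  obtain M where M: "M \<ge> 1" "(\<forall>m\<ge>M. (\<alpha>, real m) \<in> B) \<or> (\<forall>m\<ge>M. (\<alpha>, real m) \<notin> B)"
    using eventually_mem_or_not_mem[OF cl(1) \<alpha>] .
  have "\<bar>twisted_length \<Phi> \<Delta> \<rho> B (areflect (\<alpha>, real k))\<bar> \<ge> int k - int M" if k: "k \<ge> M" for k
  proof -
    let ?s = "areflect (\<alpha>, real k)"
    have W: "?s \<in> W" using \<alpha> by (simp add: reflection_weyl mem_R_iff)
    let ?l = "\<Sum>g\<in>N ?s. if g \<in> B then - 1 else 1 :: int"
    consider "\<forall>m\<ge>M. (\<alpha>, real m) \<in> B" | "\<forall>m\<ge>M. (\<alpha>, real m) \<in> P - B"
      using M \<alpha> by (auto simp: mem_P_iff)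
    then have "\<bar>?l\<bar> \<ge> int k - int M"
    proof cases
      case 1
      then have "(\<Sum>g\<in>N ?s. if g \<in> B then 1 else - 1) \<ge> int k - int M"
        using reflection_sum_lower_bound[OF cl(2) \<alpha> M(1) _ k] by blast
      moreover have "(\<Sum>g\<in>N ?s. if g \<in> B then 1 else - 1) = - ?l"
        unfolding sum_negf[symmetric] by (intro sum.cong) auto
      ultimately show ?thesis by linarith
    next
      case 2
      have "P - (P - B) = B" using sub by auto
      then have "(\<Sum>g\<in>N ?s. if g \<in> P - B then 1 else - 1) \<ge> int k - int M"
        using reflection_sum_lower_bound[of "P - B", OF _ \<alpha> M(1) _ k] 2 cl(1) by auto
      moreover have "(\<Sum>g\<in>N ?s. if g \<in> P - B then 1 else - 1) = ?l"
        by (intro sum.cong) (auto simp: N_def)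
      ultimately show ?thesis by linarith
    qed
    then show ?thesis by (simp add: twisted_length_eq_sum[OF W])
  qed
  \<comment> \<open>The threshold uses \<open>\<bar>L\<bar>\<close> so that \<open>k - M\<close>
    exceeds \<open>L\<close> for either sign of \<open>L\<close>.\<close>
  then have "\<bar>twisted_length \<Phi> \<Delta> \<rho> B (areflect (\<alpha>, real k))\<bar> > L"
    if "k \<ge> M + nat \<bar>L\<bar> + 1" for k
    using that by (smt (verit) add_leD1 int_nat_eq of_nat_add of_nat_le_iff of_nat_1)
  then show ?thesis using that by blast
qed

section \<open>Finiteness below an element\<close>

lemma finite_twisted_step_below:
  assumes B: "biclosed \<Phi> \<Delta> B" and x: "x \<in> W"
  shows "finite {y. twisted_step \<Phi> \<Delta> \<rho> B y x}"
proof -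
  let ?l = "twisted_length \<Phi> \<Delta> \<rho> B"
  \<comment> \<open>\<open>\<bar>?l x\<bar> + 1\<close> bounds \<open>\<bar>?l y\<bar>\<close> for a
    step from \<open>y\<close> to \<open>x\<close>; the rest is the cost of passing from
    \<open>x \<circ> areflect b\<close> to \<open>areflect b\<close>.\<close>
  define L where "L = \<bar>?l x\<bar> + 1 + 2 * int (card (N x))"
  have "\<exists>K. \<forall>k\<ge>K. \<bar>?l (areflect (\<alpha>, real k))\<bar> > L" if "\<alpha> \<in> \<Phi>" for \<alpha>
    using reflection_twisted_length_unbounded[OF B that, of L] by metis
  then obtain K where K: "\<And>\<alpha> k. \<alpha> \<in> \<Phi> \<Longrightarrow> k \<ge> K \<alpha> \<Longrightarrow> \<bar>?l (areflect (\<alpha>, real k))\<bar> > L"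
    by metis
  define F where "F = (\<Union>\<alpha>\<in>\<Phi>. (\<lambda>k. (\<alpha>, real k)) ` {..<K \<alpha>})"
  have "{y. twisted_step \<Phi> \<Delta> \<rho> B y x} \<subseteq> (\<lambda>b. x \<circ> areflect b) ` F"
  proof
    fix y assume "y \<in> {y. twisted_step \<Phi> \<Delta> \<rho> B y x}"
    then obtain g where g: "g \<in> R" "x = areflect g \<circ> y" and l: "?l x = ?l y + 1"
      by (auto simp: twisted_step_def)
    \<comment> \<open>Pulling \<open>g\<close> back through \<open>x\<close> turns the left
      reflection into a right one, so that only the fixed factor \<open>x\<close> separates
      \<open>y\<close> from a reflection.\<close>
    define h where "h = inv x g"
    have h: "h \<in> R" "x h = g"
      using weyl_inv_R[OF x g(1)] weyl_bij[OF x] by (auto simp: h_def bij_is_surj surj_f_inv_f)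
    have "y = areflect g \<circ> x" using g(2) by (simp add: o_assoc areflect_comp_self)
    also have "\<dots> = x \<circ> areflect h"
      using areflect_conjugate[OF weyl_linear[OF x] weyl_aform[OF x], of h] h(2) by simp
    finally have y: "y = x \<circ> areflect h" .
    \<comment> \<open>Opposite roots give the same reflection, so a positive root can be chosen; it
      lies on a string with natural levels.\<close>
    obtain b where b: "b \<in> P" "y = x \<circ> areflect b"
      using R_cases[OF h(1)] y areflect_uminus_root[of h] by metis
    have "b \<in> R" using b P_subset_R by auto
    from twisted_length_right_reflection[OF x this, of B]
    have le: "\<bar>?l (areflect b)\<bar> \<le> L" using l b(2) by (simp add: L_def)
    obtain \<alpha> k where bk: "b = (\<alpha>, real k)" "\<alpha> \<in> \<Phi>"
      using b(1) by (auto simp: aff_pos_roots_def hat_def simp del: of_nat_Suc of_nat_add split: if_splits)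
    then have "k < K \<alpha>" using le K by (meson not_le)
    then show "y \<in> (\<lambda>b. x \<circ> areflect b) ` F" using b bk by (auto simp: F_def)
  qed
  moreover have "finite F" using finite_roots by (simp add: F_def)
  ultimately show ?thesis using finite_surj by blast
qed

text \<open>Every step raises the twisted length by one; this settles the case of difference
  0.\<close>

lemma twisted_le_length:
  assumes "twisted_le \<Phi> \<Delta> \<rho> B y x"
  shows "y = x \<or> twisted_length \<Phi> \<Delta> \<rho> B y < twisted_length \<Phi> \<Delta> \<rho> B x"
  using assms unfolding twisted_le_def
  by (induction rule: rtranclp_induct) (auto simp: twisted_step_def)

lemma finite_twisted_le_below:
  assumes B: "biclosed \<Phi> \<Delta> B" and x: "x \<in> W"
  shows "finite {y. twisted_le \<Phi> \<Delta> \<rho> B y x \<and>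
    twisted_length \<Phi> \<Delta> \<rho> B x - twisted_length \<Phi> \<Delta> \<rho> B y = int n}"
  using x
proof (induction n arbitrary: x)
  case 0
  have "{y. twisted_le \<Phi> \<Delta> \<rho> B y x \<and>
    twisted_length \<Phi> \<Delta> \<rho> B x - twisted_length \<Phi> \<Delta> \<rho> B y = int 0} \<subseteq> {x}"
    using twisted_le_length by fastforce
  then show ?case using finite_subset by blast
next
  case (Suc n)
  let ?D = "\<lambda>n x. {y. twisted_le \<Phi> \<Delta> \<rho> B y x \<and>
    twisted_length \<Phi> \<Delta> \<rho> B x - twisted_length \<Phi> \<Delta> \<rho> B y = int n}"
  have "?D (Suc n) x \<subseteq> (\<Union>z\<in>{z. twisted_step \<Phi> \<Delta> \<rho> B z x}. ?D n z)"
  proof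
    fix y assume y: "y \<in> ?D (Suc n) x"
    then have "(twisted_step \<Phi> \<Delta> \<rho> B)\<^sup>*\<^sup>* y x" "y \<noteq> x" by (auto simp: twisted_le_def)
    \<comment> \<open>Splitting off the last step of the chain leaves finitely many \<open>z\<close>
      just below \<open>x\<close>, with difference \<open>n\<close> from \<open>y\<close> to
      \<open>z\<close>.\<close>
    then obtain z where z: "(twisted_step \<Phi> \<Delta> \<rho> B)\<^sup>*\<^sup>* y z" "twisted_step \<Phi> \<Delta> \<rho> B z x"
      by (cases rule: rtranclp.cases) auto
    then have "y \<in> ?D n z" using y by (auto simp: twisted_le_def twisted_step_def)
    then show "y \<in> (\<Union>z\<in>{z. twisted_step \<Phi> \<Delta> \<rho> B z x}. ?D n z)" using z by blast
  qed
  moreover have "z \<in> W" if "twisted_step \<Phi> \<Delta> \<rho> B z x" for z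
  proof -
    obtain g where g: "g \<in> R" "x = areflect g \<circ> z" using \<open>twisted_step _ _ _ _ z x\<close> by (auto simp: twisted_step_def)
    then have "z = areflect g \<circ> x" by (simp add: o_assoc areflect_comp_self)
    then show ?thesis using aff_weyl.mult g Suc.prems by blast
  qed
  ultimately show ?case
    using Suc.IH finite_twisted_step_below[OF B Suc.prems] by (elim finite_subset) blast
qed

end

theorem proposition3p5:
  fixes \<Phi> \<Delta> :: "'a::euclidean_space set" and \<rho> :: 'a
    and B :: "('a \<times> real) set" and x :: "'a \<times> real \<Rightarrow> 'a \<times> real" and n :: nat
  assumes "root_system \<Phi>" and "crystallographic \<Phi>" and "irreducible_roots \<Phi>"
    and "simple_system \<Phi> \<Delta>" and "highest_root \<Phi> \<Delta> \<rho>"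
    and "x \<in> aff_weyl \<Phi> \<Delta>"
    and "biclosed \<Phi> \<Delta> B"
  shows "finite {y \<in> aff_weyl \<Phi> \<Delta>. twisted_le \<Phi> \<Delta> \<rho> B y x \<and>
           twisted_length \<Phi> \<Delta> \<rho> B x - twisted_length \<Phi> \<Delta> \<rho> B y = int n}"
proof -
  interpret affine_root_data \<Phi> \<Delta> \<rho>
    by standard (use assms in auto)
  show ?thesis
    by (rule finite_subset[OF _ finite_twisted_le_below[OF assms(7,6), of n]]) auto
qed

end
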